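(* Let $G$ be a non-Hausdorff étale groupoid. Assume that $G$ can be covered by countably many open bisections, and that $\tilde{X}_{\mathrm{sing}}=\emptyset$, i.e., $\pi^{-1}(D)$ has empty interior in $\tilde{X}$. Then the singular ideal $J$ vanishes. If $G$ is ample, then $J_R$ vanishes for any ring $R$.
   Context: Groupoids. A groupoid $G$ is a small category all of whose morphisms are invertible, identified with its set of morphisms; $G^{(0)}\subseteq G$ is its set of units, $r,s\colon G\to G^{(0)}$ are range and source, and $G_x=s^{-1}(x)$. Topological groupoids (continuous range, source, multiplication, inversion) are always assumed locally compact with $G^{(0)}$ Hausdorff in the subspace topology; $G$ itself need not be Hausdorff, and compact subsets need not be closed. $G$ is étale if $r$ is a local homeomorphism, and ample if in addition $G^{(0)}$ is totally disconnected. An open bisection is an open subset $U\subseteq G$ on which $r$ and $s$ are injective ($U$ is then locally compact Hausdorff). Write $X=G^{(0)}$. Algebras and singular ideals. For an open bisection $U$, $C_c(U)$ is the set of continuous functions $U\to\mathbb{C}$ with compact support in $U$, extended by zero to $G$; $\mathcal{C}_c(G)$ is the linear span of all $C_c(U)$, a $*$-algebra under $f^*(g)=\overline{f(g^{-1})}$ and convolution. For $x\in X$, $\pi_x\colon\mathcal{C}_c(G)\to\mathcal{L}(\ell^2(G_x))$ is $\pi_x(f)\xi=f*\xi$; $C^*_r(G)$ is the completion of $\mathcal{C}_c(G)$ in the norm $\sup_{x}\|\pi_x(f)\|$. Elements $f\in C^*_r(G)$ are viewed as functions on $G$ via $f(g)=\langle\pi_{s(g)}(f)\delta_{s(g)},\delta_g\rangle$.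 Rings need not be commutative or unital; for $G$ ample, $RG$ is the span of the functions $c_U\colon G\to R$ ($c\in R$, $U$ compact open bisection), where $c_U$ equals $c$ on $U$ and $0$ elsewhere. With $\mathrm{supp}^\circ(f)=\{f\neq0\}$, set $J=\{f\in C^*_r(G):s(\mathrm{supp}^\circ(f))\text{ has empty interior}\}$ and $J_R=\{f\in RG:\mathrm{supp}^\circ(f)\text{ has empty interior}\}$. Unit space of the Hausdorff cover. Equip the set of closed subsets of $G$ with the Fell topology, with basis the sets $\{F: F\cap U_i\neq\emptyset\ (1\le i\le n),\ F\cap K=\emptyset\}$ for $U_1,\dots,U_n\subseteq G$ open and $K\subseteq G$ compact. $\tilde{G}$ (the Hausdorff cover) is the closure of $\{\{g\}:g\in G\}$ in the space of non-empty closed subsets, and $\tilde{X}$ is the closure of $\{\{x\}:x\in X\}$ in $\tilde{G}$. The continuous surjection $\pi\colon\tilde{X}\to X$ is determined by $\{\pi(\mathbf{x})\}=\mathbf{x}\cap X$. Let $\overline{X}$ be the closure of $X$ in $G$ and $D=s(\overline{X}\setminus X)$ (equivalently, $D=\pi(\tilde{X}\setminus\{\{x\}:x\in X\})$). Put $\tilde{X}_{\mathrm{sing}}=\mathrm{int}(\pi^{-1}(D))\subseteq\tilde{X}$. *)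

theory Defs
  imports "HOL-Analysis.Analysis"
begin

section \<open>Etale and ample groupoids\<close>

definition local_homeomorphism :: "'a topology \<Rightarrow> 'b topology \<Rightarrow> ('a \<Rightarrow> 'b) \<Rightarrow> bool" where
  "local_homeomorphism X Y p \<longleftrightarrow>
     p \<in> topspace X \<rightarrow> topspace Y \<and>
     (\<forall>x\<in>topspace X. \<exists>U. openin X U \<and> x \<in> U \<and> openin Y (p ` U) \<and>
        homeomorphic_map (subtopology X U) (subtopology Y (p ` U)) p)"

definition totally_disconnected_space :: "'a topology \<Rightarrow> bool" where
  "totally_disconnected_space X \<longleftrightarrow> (\<forall>C. connectedin X C \<longrightarrow> (\<exists>a. C \<subseteq> {a}))"

text \<open>A groupoid is identified with its set of morphisms, which is the underlying set of the
  topology \<open>gtop\<close>. The product \<open>mul G g h\<close> is meaningful when \<open>src G g = rng G h\<close>.\<close>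

record 'g top_groupoid =
  gtop :: "'g topology"
  units :: "'g set"
  rng :: "'g \<Rightarrow> 'g"
  src :: "'g \<Rightarrow> 'g"
  mul :: "'g \<Rightarrow> 'g \<Rightarrow> 'g"
  ginv :: "'g \<Rightarrow> 'g"

abbreviation arrows :: "'g top_groupoid \<Rightarrow> 'g set" where
  "arrows G \<equiv> topspace (gtop G)"

abbreviation unit_top :: "'g top_groupoid \<Rightarrow> 'g topology" where
  "unit_top G \<equiv> subtopology (gtop G) (units G)"

definition composable :: "'g top_groupoid \<Rightarrow> ('g \<times> 'g) set" where
  "composable G = {(g, h). g \<in> arrows G \<and> h \<in> arrows G \<and> src G g = rng G h}"

locale groupoid =
  fixes G :: "'g top_groupoid"
  assumes units_subset: "units G \<subseteq> arrows G"
    and rng_in: "g \<in> arrows G \<Longrightarrow> rng G g \<in> units G"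
    and src_in: "g \<in> arrows G \<Longrightarrow> src G g \<in> units G"
    and rng_unit: "x \<in> units G \<Longrightarrow> rng G x = x"
    and src_unit: "x \<in> units G \<Longrightarrow> src G x = x"
    and mul_in: "(g, h) \<in> composable G \<Longrightarrow> mul G g h \<in> arrows G"
    and rng_mul: "(g, h) \<in> composable G \<Longrightarrow> rng G (mul G g h) = rng G g"
    and src_mul: "(g, h) \<in> composable G \<Longrightarrow> src G (mul G g h) = src G h"
    and mul_assoc: "\<lbrakk>(g, h) \<in> composable G; (h, k) \<in> composable G\<rbrakk> \<Longrightarrow>
      mul G (mul G g h) k = mul G g (mul G h k)"
    and unit_left: "g \<in> arrows G \<Longrightarrow> mul G (rng G g) g = g"
    and unit_right: "g \<in> arrows G \<Longrightarrow> mul G g (src G g) = g"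
    and inv_in: "g \<in> arrows G \<Longrightarrow> ginv G g \<in> arrows G"
    and rng_inv: "g \<in> arrows G \<Longrightarrow> rng G (ginv G g) = src G g"
    and src_inv: "g \<in> arrows G \<Longrightarrow> src G (ginv G g) = rng G g"
    and inv_left: "g \<in> arrows G \<Longrightarrow> mul G (ginv G g) g = src G g"
    and inv_right: "g \<in> arrows G \<Longrightarrow> mul G g (ginv G g) = rng G g"

locale topological_groupoid = groupoid +
  assumes continuous_rng: "continuous_map (gtop G) (unit_top G) (rng G)"
    and continuous_src: "continuous_map (gtop G) (unit_top G) (src G)"
    and continuous_mul:
      "continuous_map (subtopology (prod_topology (gtop G) (gtop G)) (composable G)) (gtop G)
         (\<lambda>(g, h). mul G g h)"
    and continuous_inv: "continuous_map (gtop G) (gtop G) (ginv G)"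
    and locally_compact: "locally_compact_space (gtop G)"
    and Hausdorff_units: "Hausdorff_space (unit_top G)"

locale etale_groupoid = topological_groupoid +
  assumes rng_local_homeomorphism: "local_homeomorphism (gtop G) (unit_top G) (rng G)"

locale ample_groupoid = etale_groupoid +
  assumes units_totally_disconnected: "totally_disconnected_space (unit_top G)"

definition open_bisection :: "'g top_groupoid \<Rightarrow> 'g set \<Rightarrow> bool" where
  "open_bisection G U \<longleftrightarrow> openin (gtop G) U \<and> inj_on (rng G) U \<and> inj_on (src G) U"

definition source_fibre :: "'g top_groupoid \<Rightarrow> 'g \<Rightarrow> 'g set" where
  "source_fibre G x = {g \<in> arrows G. src G g = x}"

definition open_support :: "'g top_groupoid \<Rightarrow> ('g \<Rightarrow> 'b::zero) \<Rightarrow> 'g set" where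
  "open_support G f = {g \<in> arrows G. f g \<noteq> 0}"

section \<open>The convolution algebra and the reduced groupoid C*-algebra\<close>

text \<open>Functions on the groupoid are total functions vanishing outside \<open>arrows G\<close>.\<close>

definition Cc_bisection :: "'g top_groupoid \<Rightarrow> 'g set \<Rightarrow> ('g \<Rightarrow> complex) set" where
  "Cc_bisection G U =
     {f. continuous_map (subtopology (gtop G) U) euclidean f \<and>
         compactin (subtopology (gtop G) U)
           (subtopology (gtop G) U closure_of {g \<in> U. f g \<noteq> 0}) \<and>
         (\<forall>g. g \<notin> U \<longrightarrow> f g = 0)}"

definition Cc_algebra :: "'g top_groupoid \<Rightarrow> ('g \<Rightarrow> complex) set" where
  "Cc_algebra G =
     {(\<lambda>g. \<Sum>\<phi>\<in>F. c \<phi> * \<phi> g) | F c.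
        finite F \<and> F \<subseteq> (\<Union>U\<in>{U. open_bisection G U}. Cc_bisection G U)}"

definition convolution ::
  "'g top_groupoid \<Rightarrow> ('g \<Rightarrow> complex) \<Rightarrow> ('g \<Rightarrow> complex) \<Rightarrow> 'g \<Rightarrow> complex" where
  "convolution G f \<xi> = (\<lambda>g. if g \<in> arrows G
     then \<Sum>\<^sub>\<infinity>h\<in>{h \<in> arrows G. rng G h = rng G g}. f h * \<xi> (mul G (ginv G h) g) else 0)"

definition l2 :: "'a set \<Rightarrow> ('a \<Rightarrow> complex) set" where
  "l2 A = {\<xi>. (\<forall>a. a \<notin> A \<longrightarrow> \<xi> a = 0) \<and> (\<lambda>a. (cmod (\<xi> a))\<^sup>2) summable_on A}"

definition l2_norm :: "'a set \<Rightarrow> ('a \<Rightarrow> complex) \<Rightarrow> real" where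
  "l2_norm A \<xi> = sqrt (\<Sum>\<^sub>\<infinity>a\<in>A. (cmod (\<xi> a))\<^sup>2)"

definition l2_inner :: "'a set \<Rightarrow> ('a \<Rightarrow> complex) \<Rightarrow> ('a \<Rightarrow> complex) \<Rightarrow> complex" where
  "l2_inner A \<xi> \<eta> = (\<Sum>\<^sub>\<infinity>a\<in>A. \<xi> a * cnj (\<eta> a))"

definition l2_delta :: "'a \<Rightarrow> 'a \<Rightarrow> complex" where
  "l2_delta a = (\<lambda>b. if b = a then 1 else 0)"

text \<open>An operator family assigns to each unit \<open>x\<close> an operator on \<open>l2 (source_fibre G x)\<close>; outside
  the units and outside this space it takes the value 0.\<close>

type_synonym 'g op_family = "'g \<Rightarrow> ('g \<Rightarrow> complex) \<Rightarrow> 'g \<Rightarrow> complex"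

definition family_norm :: "'g top_groupoid \<Rightarrow> 'g op_family \<Rightarrow> ennreal" where
  "family_norm G a =
     (SUP x\<in>units G. SUP \<xi>\<in>{\<xi> \<in> l2 (source_fibre G x). l2_norm (source_fibre G x) \<xi> \<le> 1}.
        ennreal (l2_norm (source_fibre G x) (a x \<xi>)))"

definition bounded_families :: "'g top_groupoid \<Rightarrow> 'g op_family set" where
  "bounded_families G =
     {a. (\<forall>x\<in>units G. \<forall>\<xi>\<in>l2 (source_fibre G x).
            a x \<xi> \<in> l2 (source_fibre G x) \<and>
            (\<forall>\<eta>\<in>l2 (source_fibre G x). a x (\<lambda>g. \<xi> g + \<eta> g) = (\<lambda>g. a x \<xi> g + a x \<eta> g)) \<and>
            (\<forall>c. a x (\<lambda>g. c * \<xi> g) = (\<lambda>g. c * a x \<xi> g))) \<and>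
         (\<forall>x \<xi>. x \<notin> units G \<or> \<xi> \<notin> l2 (source_fibre G x) \<longrightarrow> a x \<xi> = (\<lambda>g. 0)) \<and>
         family_norm G a < \<infinity>}"

definition regular_rep :: "'g top_groupoid \<Rightarrow> ('g \<Rightarrow> complex) \<Rightarrow> 'g op_family" where
  "regular_rep G f = (\<lambda>x \<xi>. if x \<in> units G \<and> \<xi> \<in> l2 (source_fibre G x)
     then convolution G f \<xi> else (\<lambda>g. 0))"

text \<open>The map \<open>f \<mapsto> (\<pi>\<^sub>x(f))\<^sub>x\<close> is isometric from the convolution algebra with the reduced norm
  into the Banach space of bounded operator families with the supremum norm. The completion is
  therefore realised as the closure of its image.\<close>

definition reduced_algebra :: "'g top_groupoid \<Rightarrow> 'g op_family set" where
  "reduced_algebra G =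
     {a \<in> bounded_families G. \<forall>\<epsilon>>0. \<exists>f\<in>Cc_algebra G.
        family_norm G (\<lambda>x \<xi> g. a x \<xi> g - regular_rep G f x \<xi> g) < ennreal \<epsilon>}"

definition family_fun :: "'g top_groupoid \<Rightarrow> 'g op_family \<Rightarrow> 'g \<Rightarrow> complex" where
  "family_fun G a = (\<lambda>g. if g \<in> arrows G
     then l2_inner (source_fibre G (src G g)) (a (src G g) (l2_delta (src G g))) (l2_delta g)
     else 0)"

definition singular_ideal :: "'g top_groupoid \<Rightarrow> 'g op_family set" where
  "singular_ideal G =
     {a \<in> reduced_algebra G.
        unit_top G interior_of (src G ` open_support G (family_fun G a)) = {}}"

section \<open>The algebra over a ring\<close>

text \<open>The coefficient ring need not have a unit, and the span is the set of finite sums of the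
  functions \<open>c\<^sub>U\<close> with arbitrary coefficients \<open>c\<close>.\<close>

definition ring_algebra :: "'g top_groupoid \<Rightarrow> ('g \<Rightarrow> 'r::ring) set" where
  "ring_algebra G =
     {(\<lambda>g. \<Sum>i<n. if g \<in> U i then c i else 0) | (n::nat) U c.
        \<forall>i<n. open_bisection G (U i) \<and> compactin (gtop G) (U i)}"

definition ring_singular_ideal :: "'g top_groupoid \<Rightarrow> ('g \<Rightarrow> 'r::ring) set" where
  "ring_singular_ideal G =
     {f \<in> ring_algebra G. gtop G interior_of (open_support G f) = {}}"

section \<open>The unit space of the Hausdorff cover\<close>

text \<open>The generating sets are closed under finite intersections, hence form a basis.\<close>

definition fell_topology :: "'a topology \<Rightarrow> 'a set topology" where
  "fell_topology T = topology_generated_by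
     {{F. closedin T F \<and> (\<forall>U\<in>\<U>. F \<inter> U \<noteq> {}) \<and> F \<inter> K = {}} | \<U> K.
        finite \<U> \<and> (\<forall>U\<in>\<U>. openin T U) \<and> compactin T K}"

definition hausdorff_cover :: "'g top_groupoid \<Rightarrow> 'g set topology" where
  "hausdorff_cover G =
     (let N = subtopology (fell_topology (gtop G)) {F. F \<noteq> {}}
      in subtopology N (N closure_of {{g} | g. g \<in> arrows G}))"

definition cover_units :: "'g top_groupoid \<Rightarrow> 'g set topology" where
  "cover_units G =
     subtopology (hausdorff_cover G) (hausdorff_cover G closure_of {{x} | x. x \<in> units G})"

definition cover_proj :: "'g top_groupoid \<Rightarrow> 'g set \<Rightarrow> 'g" where
  "cover_proj G F = the_elem (F \<inter> units G)"

definition non_Hausdorff_units :: "'g top_groupoid \<Rightarrow> 'g set" where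
  "non_Hausdorff_units G = src G ` (gtop G closure_of units G - units G)"

definition cover_units_sing :: "'g top_groupoid \<Rightarrow> 'g set set" where
  "cover_units_sing G = cover_units G interior_of
     {F \<in> topspace (cover_units G). cover_proj G F \<in> non_Hausdorff_units G}"

end

theory Submission
  imports Defs
begin

text \<open>Let \<open>f\<close> be a function in one of the two ideals with \<open>f(g) \<noteq> 0\<close>.
  Let \<open>D\<close> be the set of non-Hausdorff units. If \<open>y \<notin> D\<close>, then
  \<open>{x}\<close> tends to \<open>{y}\<close> in the Fell topology whenever the unit \<open>x\<close> tends
  to \<open>y\<close>, so \<open>f\<close> is continuous at every arrow with range outside \<open>D\<close>,
  and it suffices to find such an arrow with \<open>f \<noteq> 0\<close>. At \<open>g\<close> itself
  \<open>f\<close> need not be continuous, but \<open>f(w)\<close> tends to \<open>f(g)\<close> when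
  \<open>w\<close> tends to \<open>g\<close> and \<open>{r(w)}\<close> tends to \<open>{r(g)}\<close> in the
  Fell topology: if \<open>f\<close> is supported on a compact set \<open>L\<close> not containing
  \<open>g\<close>, and \<open>C\<close> is a small compact neighbourhood of \<open>g\<close>, then \<open>w
  \<in> L \<inter> C\<close> forces \<open>r(w)\<close> into the compact set \<open>L
  C\<^sup>-\<^sup>1\<close>, which does not contain \<open>r(g)\<close>. Since
  \<open>\<pi>\<^sup>-\<^sup>1(D)\<close> has empty interior, every Fell neighbourhood of
  \<open>{r(g)}\<close> contains some \<open>{y}\<close> with \<open>y \<notin> D\<close>. Using ranges
  instead of sources is harmless, because \<open>r = s\<close> on the closure of the unit space.\<close>

section \<open>Groupoid algebra\<close>

context groupoid
begin

lemma composable_iff: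
  "(g, h) \<in> composable G \<longleftrightarrow> g \<in> arrows G \<and> h \<in> arrows G \<and> src G g = rng G h"
  by (simp add: composable_def)

lemma unit_arrow: "x \<in> units G \<Longrightarrow> x \<in> arrows G"
  using units_subset by auto

lemma mul_inv_cancel_right:
  assumes "(g, h) \<in> composable G"
  shows "mul G (mul G g h) (ginv G h) = g"
  using assms mul_assoc[of g h "ginv G h"] unit_right[of g]
  by (simp add: composable_iff inv_in rng_inv inv_right)

lemma mul_inv_cancel_right':
  assumes "g \<in> arrows G" "h \<in> arrows G" "src G g = src G h"
  shows "mul G (mul G g (ginv G h)) h = g"
  using assms mul_assoc[of g "ginv G h" h] unit_right[of g]
  by (simp add: composable_iff inv_in rng_inv src_inv inv_left)

lemma mul_inv_cancel_left:
  assumes "g \<in> arrows G" "h \<in> arrows G" "rng G g = rng G h"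
  shows "mul G g (mul G (ginv G g) h) = h"
  using assms mul_assoc[of g "ginv G g" h] unit_left[of h]
  by (simp add: composable_iff inv_in rng_inv src_inv inv_right)

lemma inv_inv:
  assumes "g \<in> arrows G"
  shows "ginv G (ginv G g) = g"
proof -
  have "mul G (mul G g (ginv G g)) (ginv G (ginv G g)) = g"
    using assms by (intro mul_inv_cancel_right) (simp add: composable_iff inv_in rng_inv)
  then show ?thesis
    using assms unit_left[of "ginv G (ginv G g)"]
    by (simp add: inv_in rng_inv src_inv inv_right)
qed

lemma mul_inv_in:
  assumes "g \<in> arrows G" "h \<in> arrows G" "src G g = src G h"
  shows "mul G g (ginv G h) \<in> arrows G"
    and "rng G (mul G g (ginv G h)) = rng G g"
    and "src G (mul G g (ginv G h)) = rng G h"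
proof -
  have "(g, ginv G h) \<in> composable G"
    using assms by (simp add: composable_iff inv_in rng_inv)
  then show "mul G g (ginv G h) \<in> arrows G" "rng G (mul G g (ginv G h)) = rng G g"
    "src G (mul G g (ginv G h)) = rng G h"
    using assms by (simp_all add: mul_in rng_mul src_mul src_inv)
qed

text \<open>A unit is its own source, so \<open>g h^{-1}\<close> must be the range of
  \<open>h\<close>; multiplying by \<open>h\<close> on the right cancels it.\<close>

lemma mul_inv_eq_unitD:
  assumes "g \<in> arrows G" "h \<in> arrows G" "src G g = src G h" "mul G g (ginv G h) \<in> units G"
  shows "g = h"
proof -
  have "mul G g (ginv G h) = rng G h"
    using assms mul_inv_in(3)[of g h] src_unit by auto
  then show ?thesis
    using assms mul_inv_cancel_right'[of g h] unit_left[of h] by simp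
qed

end

section \<open>Topology of etale groupoids\<close>

context topological_groupoid
begin

lemma openin_rng_vimage:
  assumes "openin (unit_top G) A"
  shows "openin (gtop G) {g \<in> arrows G. rng G g \<in> A}"
  using openin_continuous_map_preimage[OF continuous_rng assms] by simp

lemma openin_src_vimage:
  assumes "openin (unit_top G) A"
  shows "openin (gtop G) {g \<in> arrows G. src G g \<in> A}"
  using openin_continuous_map_preimage[OF continuous_src assms] by simp

lemma topspace_units [simp]: "topspace (unit_top G) = units G"
  using units_subset by auto

lemma units_separated:
  assumes "x \<in> units G" "y \<in> units G" "x \<noteq> y"
  obtains A B where "openin (unit_top G) A" "openin (unit_top G) B" "x \<in> A" "y \<in> B" "A \<inter> B = {}"
  using Hausdorff_units assms unfolding Hausdorff_space_def disjnt_def by (metis topspace_units)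

text \<open>The set is \<open>L C^{-1}\<close>. Pairs with equal sources form a closed set because
  the unit space is Hausdorff, so those in \<open>L \<times> C\<close> form a compact set even if
  \<open>G\<close> is not Hausdorff, and \<open>(l, c) \<mapsto> l c^{-1}\<close> is continuous
  there.\<close>

lemma compactin_mul_inv:
  assumes "compactin (gtop G) L" "compactin (gtop G) C"
  shows "compactin (gtop G) ((\<lambda>(l, c). mul G l (ginv G c)) ` {(l, c). l \<in> L \<and> c \<in> C \<and> src G l = src G c})"
    (is "compactin _ (?m ` ?S)")
proof -
  let ?P = "prod_topology (gtop G) (gtop G)"
  have sub: "L \<subseteq> arrows G" "C \<subseteq> arrows G"
    using assms compactin_subset_topspace by auto
  have cont: "continuous_map ?P (gtop G) fst" "continuous_map ?P (gtop G) snd"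
    by (simp_all add: continuous_map_fst continuous_map_snd)
  let ?E = "{p \<in> topspace ?P. (src G \<circ> fst) p = (src G \<circ> snd) p}"
  have "closedin ?P ?E"
    by (rule closedin_continuous_maps_eq[OF Hausdorff_units
        continuous_map_compose[OF cont(1) continuous_src] continuous_map_compose[OF cont(2) continuous_src]])
  moreover have "compactin ?P (L \<times> C)"
    using assms by (simp add: compactin_Times)
  ultimately have "compactin ?P (?E \<inter> L \<times> C)"
    by (rule closed_Int_compactin)
  then have comp: "compactin (subtopology ?P ?E) (?E \<inter> L \<times> C)"
    by (simp add: compactin_subtopology)
  let ?q = "\<lambda>p. (fst p, ginv G (snd p))"
  have "continuous_map ?P ?P ?q"
    using continuous_map_compose[OF cont(2) continuous_inv] cont(1)
    by (intro continuous_map_pairedI) (simp_all add: o_def)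
  then have "continuous_map (subtopology ?P ?E) (subtopology ?P (composable G)) ?q"
    by (auto simp: continuous_map_in_subtopology continuous_map_from_subtopology
        composable_def inv_in rng_inv)
  then have "continuous_map (subtopology ?P ?E) (gtop G) ((\<lambda>(g, h). mul G g h) \<circ> ?q)"
    using continuous_mul by (rule continuous_map_compose)
  from image_compactin[OF comp this]
  have "compactin (gtop G) (((\<lambda>(g, h). mul G g h) \<circ> ?q) ` (?E \<inter> L \<times> C))" .
  moreover have "((\<lambda>(g, h). mul G g h) \<circ> ?q) ` (?E \<inter> L \<times> C) = ?m ` ?S"
  proof -
    have "?E \<inter> L \<times> C = ?S" using sub by auto
    then show ?thesis by (simp add: o_def case_prod_unfold)
  qed
  ultimately show ?thesis by simp
qed

text \<open>A point of \<open>K\<close> with source \<open>y\<close> is not a unit, hence not in the closure of the units either. So every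
  point of \<open>K\<close> can be separated from the units near \<open>y\<close>, and compactness applies.\<close>

lemma compact_avoids_Hausdorff_unit:
  assumes y: "y \<in> units G" "y \<notin> non_Hausdorff_units G"
    and K: "compactin (gtop G) K" "y \<notin> K"
  obtains N where "openin (unit_top G) N" "y \<in> N" "N \<inter> K = {}"
proof (rule ccontr)
  assume "\<not> thesis"
  with that have meets: "\<And>N. openin (unit_top G) N \<Longrightarrow> y \<in> N \<Longrightarrow> N \<inter> K \<noteq> {}"
    by blast
  have "\<exists>B N. openin (gtop G) B \<and> k \<in> B \<and> openin (unit_top G) N \<and> y \<in> N \<and> N \<inter> B = {}"
    if k: "k \<in> K" for k
  proof (cases "src G k = y")
    case True
    have ka: "k \<in> arrows G" using K k compactin_subset_topspace by blast
    have "k \<notin> units G" using True k K(2) src_unit by auto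
    then have "k \<notin> gtop G closure_of units G"
      using y True unfolding non_Hausdorff_units_def by blast
    then obtain B where "openin (gtop G) B" "k \<in> B" "B \<inter> units G = {}"
      using ka by (auto simp: in_closure_of)
    then show ?thesis
      using y openin_topspace[of "unit_top G"] by (metis topspace_units inf_commute)
  next
    case False
    have ka: "k \<in> arrows G" using K k compactin_subset_topspace by blast
    obtain A B where AB: "openin (unit_top G) A" "openin (unit_top G) B" "src G k \<in> A" "y \<in> B" "A \<inter> B = {}"
      using units_separated[of "src G k" y] False ka y src_in by metis
    have "B \<subseteq> units G" using openin_subset[OF AB(2)] by simp
    then have "src G b \<notin> A" if "b \<in> B" for b
      using that AB(5) src_unit by (metis disjoint_iff subsetD)
    then have "B \<inter> {g \<in> arrows G. src G g \<in> A} = {}"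
      by blast
    then show ?thesis
      using openin_src_vimage[OF AB(1)] AB(2-4) ka
      by (intro exI[of _ "{g \<in> arrows G. src G g \<in> A}"] exI[of _ B]) simp
  qed
  then obtain B N where BN: "\<And>k. k \<in> K \<Longrightarrow> openin (gtop G) (B k) \<and> k \<in> B k \<and>
      openin (unit_top G) (N k) \<and> y \<in> N k \<and> N k \<inter> B k = {}"
    by metis
  have "\<exists>\<F>. finite \<F> \<and> \<F> \<subseteq> B ` K \<and> K \<subseteq> \<Union>\<F>"
    using BN by (intro compactinD[OF K(1)]) auto
  then obtain F where F: "finite F" "F \<subseteq> K" "K \<subseteq> \<Union>(B ` F)"
    by (metis finite_subset_image)
  \<comment> \<open>Intersecting with the whole space keeps \<open>?N\<close> open when
    \<open>F\<close> is empty, where the bare intersection would be \<open>UNIV\<close>.\<close>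
  let ?N = "(\<Inter>k\<in>F. N k) \<inter> topspace (unit_top G)"
  have "openin (unit_top G) ?N"
    by (rule openin_INT[OF F(1)]) (use BN F(2) in blast)
  moreover have "y \<in> ?N"
    using F(2) BN y(1) unfolding topspace_units by blast
  moreover have "?N \<inter> K = {}"
  proof -
    have "z \<notin> ?N" if "z \<in> K" for z
    proof -
      obtain k where "k \<in> F" "z \<in> B k" using F(3) \<open>z \<in> K\<close> by blast
      then have "z \<notin> N k" using BN F(2) by blast
      then show ?thesis using \<open>k \<in> F\<close> by blast
    qed
    then show ?thesis by blast
  qed
  ultimately show False using meets by blast
qed

end

section \<open>Open range map, units and compact neighbourhoods\<close>

context etale_groupoid
begin

lemma open_map_rng: "open_map (gtop G) (unit_top G) (rng G)"
  unfolding open_map_def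
proof (intro allI impI)
  fix W assume W: "openin (gtop G) W"
  show "openin (unit_top G) (rng G ` W)"
  proof (subst openin_subopen, intro ballI)
    fix y assume "y \<in> rng G ` W"
    then obtain w where w: "w \<in> W" "y = rng G w" by blast
    then have "w \<in> arrows G" using W openin_subset by blast
    then obtain U where U: "openin (gtop G) U" "w \<in> U" "openin (unit_top G) (rng G ` U)"
      "homeomorphic_map (subtopology (gtop G) U) (subtopology (unit_top G) (rng G ` U)) (rng G)"
      using rng_local_homeomorphism unfolding local_homeomorphism_def by blast
    have "openin (subtopology (gtop G) U) (U \<inter> W)"
      using W by (auto simp: openin_subtopology)
    then have "openin (subtopology (unit_top G) (rng G ` U)) (rng G ` (U \<inter> W))"
      using homeomorphic_imp_open_map[OF U(4)] by (simp add: open_map_def)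
    then have "openin (unit_top G) (rng G ` (U \<inter> W))"
      using U(3) by (simp add: openin_open_subtopology)
    then show "\<exists>T. openin (unit_top G) T \<and> y \<in> T \<and> T \<subseteq> rng G ` W"
      using w U by blast
  qed
qed

text \<open>Inversion is continuous and exchanges range and source, so openness of the range map
  carries over.\<close>

lemma openin_src_image:
  assumes "openin (gtop G) W"
  shows "openin (unit_top G) (src G ` W)"
proof -
  have sub: "W \<subseteq> arrows G" using assms openin_subset by blast
  have "src G ` W = rng G ` {g \<in> arrows G. ginv G g \<in> W}"
  proof (intro equalityI subsetI)
    fix y assume "y \<in> src G ` W"
    then obtain w where "w \<in> W" "y = src G w" by blast
    then show "y \<in> rng G ` {g \<in> arrows G. ginv G g \<in> W}"
      using sub by (intro image_eqI[of _ _ "ginv G w"]) (auto simp: rng_inv inv_in inv_inv)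
  next
    fix y assume "y \<in> rng G ` {g \<in> arrows G. ginv G g \<in> W}"
    then obtain g where g: "g \<in> arrows G" "ginv G g \<in> W" "y = rng G g" by blast
    then have "y = src G (ginv G g)" by (simp add: src_inv)
    then show "y \<in> src G ` W" using g(2) by (rule image_eqI)
  qed
  moreover have "openin (gtop G) {g \<in> arrows G. ginv G g \<in> W}"
    by (rule openin_continuous_map_preimage[OF continuous_inv assms])
  ultimately show ?thesis
    using open_map_rng unfolding open_map_def by simp
qed

lemma openin_units: "openin (gtop G) (units G)"
proof (subst openin_subopen, intro ballI)
  fix x assume x: "x \<in> units G"
  then obtain U where U: "openin (gtop G) U" "x \<in> U"
      "homeomorphic_map (subtopology (gtop G) U) (subtopology (unit_top G) (rng G ` U)) (rng G)"
    using rng_local_homeomorphism unit_arrow unfolding local_homeomorphism_def by blast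
  have sub: "U \<subseteq> arrows G" using U openin_subset by blast
  have inj: "inj_on (rng G) U"
    using homeomorphic_imp_injective_map[OF U(3)] sub by (simp add: Int_absorb1)
  \<comment> \<open>For \<open>g\<close> in \<open>?V\<close>, both \<open>g\<close> and
    \<open>rng G g\<close> lie in \<open>U\<close> and have the same range, so injectivity on
    \<open>U\<close> makes \<open>g\<close> equal to the unit \<open>rng G g\<close>.\<close>
  let ?V = "U \<inter> {g \<in> arrows G. rng G g \<in> U \<inter> units G}"
  have "openin (unit_top G) (U \<inter> units G)" using U(1) by (auto simp: openin_subtopology)
  then have "openin (gtop G) ?V" using U(1) openin_rng_vimage by blast
  moreover have "x \<in> ?V" using x U rng_unit unit_arrow by simp
  moreover have "?V \<subseteq> units G"
  proof
    fix g assume g: "g \<in> ?V"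
    then have "rng G (rng G g) = rng G g" using rng_unit by blast
    then have "rng G g = g" using inj g by (auto dest!: inj_onD)
    then show "g \<in> units G" using g by auto
  qed
  ultimately show "\<exists>T. openin (gtop G) T \<and> x \<in> T \<and> T \<subseteq> units G" by blast
qed

lemma openin_unit_top: "openin (unit_top G) A \<Longrightarrow> openin (gtop G) A"
  using openin_open_subtopology[OF openin_units, of A] by simp

text \<open>Only closed sets are points of the Fell space, so this is what admits \<open>{x}\<close>
  there. An arrow with another range is separated from \<open>x\<close> through the Hausdorff unit
  space; an arrow other than \<open>x\<close> with range \<open>x\<close> has a neighbourhood on
  which the range is injective, and this cannot contain \<open>x\<close>.\<close>

lemma closedin_unit:
  assumes x: "x \<in> units G"
  shows "closedin (gtop G) {x}"
proof -
  have "openin (gtop G) (arrows G - {x})"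
  proof (subst openin_subopen, intro ballI)
    fix g assume g: "g \<in> arrows G - {x}"
    show "\<exists>T. openin (gtop G) T \<and> g \<in> T \<and> T \<subseteq> arrows G - {x}"
    proof (cases "rng G g = x")
      case True
      obtain U where U: "openin (gtop G) U" "g \<in> U"
          "homeomorphic_map (subtopology (gtop G) U) (subtopology (unit_top G) (rng G ` U)) (rng G)"
        using rng_local_homeomorphism g unfolding local_homeomorphism_def by blast
      have sub: "U \<subseteq> arrows G" using U openin_subset by blast
      have "inj_on (rng G) U"
        using homeomorphic_imp_injective_map[OF U(3)] sub by (simp add: Int_absorb1)
      then have "x \<notin> U" using True g U(2) rng_unit[OF x] by (metis DiffD2 inj_onD singletonI)
      then show ?thesis using U sub by blast
    next
      case False
      then obtain A B where "openin (unit_top G) A" "rng G g \<in> A" "x \<in> B" "A \<inter> B = {}"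
        using units_separated[of "rng G g" x] x g rng_in by (metis DiffD1)
      then show ?thesis
        using g rng_unit[OF x] by (intro exI[of _ "{h \<in> arrows G. rng G h \<in> A}"]) (auto simp: openin_rng_vimage)
    qed
  qed
  then show ?thesis using x unit_arrow by (auto simp: closedin_def)
qed

text \<open>For a space that is not Hausdorff, local compactness only provides one compact neighbourhood of
  each point. Small ones are found in the unit space, which is Hausdorff, and moved along \<open>rng\<close>.\<close>

lemma locally_compact_units: "locally_compact_space (unit_top G)"
  unfolding locally_compact_space_def topspace_units
proof
  fix x assume x: "x \<in> units G"
  then obtain U K where UK: "openin (gtop G) U" "compactin (gtop G) K" "x \<in> U" "U \<subseteq> K"
    using locally_compact unit_arrow[OF x] unfolding locally_compact_space_def by meson
  have "openin (unit_top G) (rng G ` U)" using open_map_rng UK by (simp add: open_map_def)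
  moreover have "compactin (unit_top G) (rng G ` K)"
    using UK(2) continuous_rng by (rule image_compactin)
  moreover have "x \<in> rng G ` U" using UK(3) rng_unit[OF x] by force
  ultimately show "\<exists>U K. openin (unit_top G) U \<and> compactin (unit_top G) K \<and> x \<in> U \<and> U \<subseteq> K"
    using UK(4) by (meson image_mono)
qed

text \<open>Having the range injective on all of the compact set \<open>C\<close> later allows an
  element of \<open>C\<close> to be identified with \<open>g\<close> from its range alone.\<close>

lemma compact_neighbourhood_inj_rng:
  assumes "g \<in> arrows G"
  obtains W C where "openin (gtop G) W" "compactin (gtop G) C" "g \<in> W" "W \<subseteq> C" "inj_on (rng G) C"
proof -
  obtain U where U: "openin (gtop G) U" "g \<in> U" "openin (unit_top G) (rng G ` U)"
      "homeomorphic_map (subtopology (gtop G) U) (subtopology (unit_top G) (rng G ` U)) (rng G)"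
    using rng_local_homeomorphism assms unfolding local_homeomorphism_def by blast
  have sub: "U \<subseteq> arrows G" using U openin_subset by blast
  have inj: "inj_on (rng G) U"
    using homeomorphic_imp_injective_map[OF U(4)] sub by (simp add: Int_absorb1)
  have "locally_compact_space (subtopology (unit_top G) (rng G ` U))"
    by (rule locally_compact_space_open_subset[OF _ locally_compact_units U(3)])
      (use Hausdorff_units in blast)
  then have "locally_compact_space (subtopology (gtop G) U)"
    using homeomorphic_locally_compact_space homeomorphic_map_imp_homeomorphic_space[OF U(4)] by blast
  moreover have "g \<in> topspace (subtopology (gtop G) U)" using assms U by simp
  ultimately obtain W C where "openin (subtopology (gtop G) U) W" "compactin (subtopology (gtop G) U) C" "g \<in> W" "W \<subseteq> C"
    unfolding locally_compact_space_def by meson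
  then show thesis
    using U(1) inj by (intro that[of W C]) (auto simp: openin_open_subtopology compactin_subtopology intro: inj_on_subset)
qed

section \<open>Continuity off compact sets of units\<close>

text \<open>If \<open>rng G g\<close> belongs to \<open>non_Hausdorff_units G\<close>, functions in \<open>Cc_algebra G\<close> can be discontinuous at \<open>g\<close>. They do
  converge along the following coarser approach: \<open>w\<close> tends to \<open>g\<close> while \<open>{rng G w}\<close> tends to \<open>{rng G g}\<close> in
  the Fell topology.\<close>

definition nhds_off_compact :: "'a \<Rightarrow> 'a filter" where
  "nhds_off_compact g = (INF (W, K)\<in>{(W, K). openin (gtop G) W \<and> g \<in> W \<and> compactin (gtop G) K \<and> rng G g \<notin> K}.
     principal {w \<in> W. rng G w \<notin> K})"

lemma eventually_nhds_off_compact: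
  assumes "g \<in> arrows G"
  shows "eventually P (nhds_off_compact g) \<longleftrightarrow>
    (\<exists>W K. openin (gtop G) W \<and> g \<in> W \<and> compactin (gtop G) K \<and> rng G g \<notin> K \<and> (\<forall>w\<in>W. rng G w \<notin> K \<longrightarrow> P w))"
proof -
  let ?I = "{(W, K). openin (gtop G) W \<and> g \<in> W \<and> compactin (gtop G) K \<and> rng G g \<notin> K}"
  let ?B = "\<lambda>(W, K). {w \<in> W. rng G w \<notin> K}"
  have "(arrows G, {}) \<in> ?I" using assms by simp
  then have ne: "?I \<noteq> {}" by (metis empty_iff)
  \<comment> \<open>The index family is directed: intersect the open sets and unite the compact
    ones.\<close>
  have dir: "\<exists>p\<in>?I. principal (?B p) \<le> inf (principal (?B a)) (principal (?B b))"
    if ab: "a \<in> ?I" "b \<in> ?I" for a b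
  proof -
    obtain W K V L where eq: "a = (W, K)" "b = (V, L)" by (metis surj_pair)
    have "(W \<inter> V, K \<union> L) \<in> ?I"
      using ab unfolding eq by (simp add: compactin_Un openin_Int)
    moreover have "principal (?B (W \<inter> V, K \<union> L)) \<le> inf (principal (?B a)) (principal (?B b))"
      unfolding eq by auto
    ultimately show ?thesis by (rule bexI[rotated])
  qed
  have "nhds_off_compact g = (INF p\<in>?I. principal (?B p))"
    by (simp add: nhds_off_compact_def case_prod_unfold)
  then have "eventually P (nhds_off_compact g) \<longleftrightarrow> (\<exists>p\<in>?I. eventually P (principal (?B p)))"
    using eventually_INF_base[OF ne dir] by simp
  then show ?thesis by (simp add: eventually_principal) blast
qed

lemma eventually_nhds_off_compactE:
  assumes "eventually P (nhds_off_compact g)" "g \<in> arrows G"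
  obtains W K where "openin (gtop G) W" "g \<in> W" "compactin (gtop G) K" "rng G g \<notin> K"
    "\<And>w. w \<in> W \<Longrightarrow> rng G w \<notin> K \<Longrightarrow> P w"
proof -
  obtain W K where "openin (gtop G) W \<and> g \<in> W \<and> compactin (gtop G) K \<and> rng G g \<notin> K \<and>
      (\<forall>w\<in>W. rng G w \<notin> K \<longrightarrow> P w)"
    using assms(1) unfolding eventually_nhds_off_compact[OF assms(2)] by (elim exE)
  then show thesis by (intro that[of W K]) simp_all
qed

lemma eventually_in_open_off_compact:
  assumes "openin (gtop G) W" "g \<in> W"
  shows "eventually (\<lambda>w. w \<in> W) (nhds_off_compact g)"
proof -
  have "g \<in> arrows G" using assms openin_subset by blast
  then show ?thesis
    unfolding eventually_nhds_off_compact[OF \<open>g \<in> arrows G\<close>]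
    using assms compactin_empty by blast
qed

lemma eventually_notin_compact:
  assumes "compactin (gtop G) L" and g: "g \<in> arrows G" "g \<notin> L"
  shows "eventually (\<lambda>w. w \<notin> L) (nhds_off_compact g)"
proof -
  obtain W C where WC: "openin (gtop G) W" "compactin (gtop G) C" "g \<in> W" "W \<subseteq> C" "inj_on (rng G) C"
    using compact_neighbourhood_inj_rng g by blast
  have sub: "L \<subseteq> arrows G" "C \<subseteq> arrows G"
    using assms WC compactin_subset_topspace by auto
  let ?K = "(\<lambda>(l, c). mul G l (ginv G c)) ` {(l, c). l \<in> L \<and> c \<in> C \<and> src G l = src G c}"
  have "rng G g \<notin> ?K"
  proof
    assume "rng G g \<in> ?K"
    then obtain l c where lc: "l \<in> L" "c \<in> C" "src G l = src G c" "rng G g = mul G l (ginv G c)"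
      by auto
    have lca: "l \<in> arrows G" "c \<in> arrows G" using lc sub by auto
    \<comment> \<open>If \<open>l c^{-1}\<close> is a unit then \<open>l = c\<close>. Its value
      \<open>rng G g\<close> is then the range of \<open>c\<close>, so injectivity on
      \<open>C\<close> gives \<open>c = g\<close>, although \<open>l \<in> L\<close> and
      \<open>g \<notin> L\<close>.\<close>
    have "mul G l (ginv G c) \<in> units G" using lc(4) g rng_in by metis
    with lca lc(3) have "l = c" by (rule mul_inv_eq_unitD)
    then have "rng G g = rng G c"
      using lc(4) lca inv_right by simp
    then have "g = c" using WC(3-5) lc(2) by (auto dest: inj_onD)
    then show False using g lc \<open>l = c\<close> by simp
  qed
  moreover have "w \<notin> L" if "w \<in> W" "rng G w \<notin> ?K" for w
  proof
    assume "w \<in> L"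
    then have "mul G w (ginv G w) \<in> ?K"
      using that(1) WC(4) by (intro image_eqI[of _ _ "(w, w)"]) auto
    moreover have "mul G w (ginv G w) = rng G w" using \<open>w \<in> L\<close> sub inv_right by blast
    ultimately show False using that(2) by simp
  qed
  moreover have "compactin (gtop G) ?K" using assms(1) WC(2) by (rule compactin_mul_inv)
  ultimately show ?thesis
    unfolding eventually_nhds_off_compact[OF g(1)] using WC(1,3) by blast
qed

text \<open>On \<open>U\<close> this is ordinary continuity. For \<open>g\<close> off
  \<open>U\<close>, the support taken in \<open>U\<close> need not be closed in \<open>G\<close>,
  but it is compact and omits \<open>g\<close>, so the filter eventually leaves it and
  \<open>f\<close> is eventually 0.\<close>

lemma tendsto_Cc_bisection:
  assumes U: "open_bisection G U" and f: "f \<in> Cc_bisection G U" and g: "g \<in> arrows G"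
  shows "(f \<longlongrightarrow> f g) (nhds_off_compact g)"
proof (cases "g \<in> U")
  case True
  have oU: "openin (gtop G) U" using U by (simp add: open_bisection_def)
  have cont: "continuous_map (subtopology (gtop G) U) euclidean f"
    using f by (simp add: Cc_bisection_def)
  show ?thesis
  proof (rule topological_tendstoI)
    fix S assume S: "open S" "f g \<in> S"
    have "openin (subtopology (gtop G) U) {u \<in> topspace (subtopology (gtop G) U). f u \<in> S}"
      using S by (intro openin_continuous_map_preimage[OF cont]) auto
    then have "openin (gtop G) {u \<in> topspace (subtopology (gtop G) U). f u \<in> S}"
      using oU by (simp add: openin_open_subtopology)
    from eventually_in_open_off_compact[OF this, of g]
    show "eventually (\<lambda>w. f w \<in> S) (nhds_off_compact g)"
      using S True g by (auto elim: eventually_mono)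
  qed
next
  case False
  let ?L = "subtopology (gtop G) U closure_of {u \<in> U. f u \<noteq> 0}"
  have L: "compactin (gtop G) ?L" "?L \<subseteq> U"
    using f by (auto simp: Cc_bisection_def compactin_subtopology)
  have "{u \<in> U. f u \<noteq> 0} \<subseteq> ?L"
    using U openin_subset by (intro closure_of_subset) (auto simp: open_bisection_def)
  then have "f w = f g" if "w \<notin> ?L" for w
    using that f False unfolding Cc_bisection_def by fastforce
  moreover have "eventually (\<lambda>w. w \<notin> ?L) (nhds_off_compact g)"
    using L False g by (intro eventually_notin_compact) auto
  ultimately show ?thesis
    by (intro tendsto_eventually) (auto elim: eventually_mono)
qed

lemma tendsto_Cc_algebra:
  assumes "f \<in> Cc_algebra G" "g \<in> arrows G"
  shows "(f \<longlongrightarrow> f g) (nhds_off_compact g)"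
proof -
  obtain F c where F: "f = (\<lambda>g. \<Sum>\<phi>\<in>F. c \<phi> * \<phi> g)" "F \<subseteq> (\<Union>U\<in>{U. open_bisection G U}. Cc_bisection G U)"
    using assms(1) unfolding Cc_algebra_def by blast
  have "(\<phi> \<longlongrightarrow> \<phi> g) (nhds_off_compact g)" if "\<phi> \<in> F" for \<phi>
    using that F(2) tendsto_Cc_bisection assms(2) by blast
  then show ?thesis
    unfolding F(1) by (intro tendsto_sum tendsto_mult tendsto_const)
qed

text \<open>Membership in each \<open>U i\<close> is eventually constant: openness settles the case
  \<open>g \<in> U i\<close>, compactness the case \<open>g \<notin> U i\<close>. So all summands
  freeze together.\<close>

lemma eventually_eq_ring_algebra:
  assumes "f \<in> ring_algebra G" and g: "g \<in> arrows G"
  shows "eventually (\<lambda>w. f w = f g) (nhds_off_compact g)"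
proof -
  obtain n :: nat and U c where f: "f = (\<lambda>g. \<Sum>i<n. if g \<in> U i then c i else 0)"
    and U: "\<And>i. i < n \<Longrightarrow> open_bisection G (U i) \<and> compactin (gtop G) (U i)"
    using assms(1) unfolding ring_algebra_def by blast
  have "eventually (\<lambda>w. w \<in> U i \<longleftrightarrow> g \<in> U i) (nhds_off_compact g)" if "i < n" for i
  proof (cases "g \<in> U i")
    case True
    then show ?thesis
      using eventually_in_open_off_compact[of "U i" g] U[OF that] by (simp add: open_bisection_def)
  next
    case False
    then show ?thesis
      using eventually_notin_compact[of "U i" g] U[OF that] g by simp
  qed
  then have "eventually (\<lambda>w. \<forall>i\<in>{..<n}. w \<in> U i \<longleftrightarrow> g \<in> U i) (nhds_off_compact g)"
    by (intro eventually_ball_finite) auto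
  then show ?thesis
    unfolding f by eventually_elim (intro sum.cong; simp)
qed

section \<open>The Hausdorff cover\<close>

text \<open>Phrased with the topspace so that the nested subspaces defining the cover can be handled
  without unfolding their closures.\<close>

lemma openin_subtopology_Int_topspace:
  assumes "openin X S"
  shows "openin (subtopology X T) (S \<inter> topspace (subtopology X T))"
proof -
  have "S \<inter> topspace (subtopology X T) = S \<inter> T" using assms openin_subset by fastforce
  then show ?thesis using assms by (simp add: openin_subtopology_Int)
qed

lemma openin_fell:
  assumes "finite \<U>" "\<And>U. U \<in> \<U> \<Longrightarrow> openin T U" "compactin T K"
  shows "openin (fell_topology T) {F. closedin T F \<and> (\<forall>U\<in>\<U>. F \<inter> U \<noteq> {}) \<and> F \<inter> K = {}}"
  unfolding fell_topology_def
  by (intro topology_generated_by_Basis CollectI exI[of _ \<U>] exI[of _ K]) (simp add: assms)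

lemma openin_cover_units:
  assumes "openin (fell_topology (gtop G)) \<O>"
  shows "openin (hausdorff_cover G) (\<O> \<inter> topspace (hausdorff_cover G))"
    and "openin (cover_units G) (\<O> \<inter> topspace (cover_units G))"
proof -
  let ?N = "subtopology (fell_topology (gtop G)) {F. F \<noteq> {}}"
  have N: "openin (subtopology ?N A) (\<O> \<inter> topspace (subtopology ?N A))" for A
  proof -
    have "openin (subtopology ?N A) (\<O> \<inter> topspace ?N \<inter> topspace (subtopology ?N A))"
      using assms by (intro openin_subtopology_Int_topspace)
    moreover have "\<O> \<inter> topspace ?N \<inter> topspace (subtopology ?N A) = \<O> \<inter> topspace (subtopology ?N A)"
      by auto
    ultimately show ?thesis by simp
  qed
  show 1: "openin (hausdorff_cover G) (\<O> \<inter> topspace (hausdorff_cover G))"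
    unfolding hausdorff_cover_def Let_def by (rule N)
  let ?H = "hausdorff_cover G"
  have H: "openin (subtopology ?H A) (\<O> \<inter> topspace (subtopology ?H A))" for A
  proof -
    have "openin (subtopology ?H A) (\<O> \<inter> topspace ?H \<inter> topspace (subtopology ?H A))"
      using 1 by (rule openin_subtopology_Int_topspace)
    moreover have "\<O> \<inter> topspace ?H \<inter> topspace (subtopology ?H A) = \<O> \<inter> topspace (subtopology ?H A)"
      by auto
    ultimately show ?thesis by simp
  qed
  show "openin (cover_units G) (\<O> \<inter> topspace (cover_units G))"
    unfolding cover_units_def by (rule H)
qed

lemma cover_unitsD:
  assumes "F \<in> topspace (cover_units G)" "openin (fell_topology (gtop G)) \<O>" "F \<in> \<O>"
  obtains x where "x \<in> units G" "{x} \<in> \<O>"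
proof -
  have F: "F \<in> hausdorff_cover G closure_of {{x} | x. x \<in> units G}"
    using assms(1) by (simp add: cover_units_def)
  then have "F \<in> \<O> \<inter> topspace (hausdorff_cover G)"
    using assms(3) by (simp add: in_closure_of)
  then obtain x where "x \<in> units G" "{x} \<in> \<O> \<inter> topspace (hausdorff_cover G)"
    using F openin_cover_units(1)[OF assms(2)] unfolding in_closure_of by blast
  then show thesis using that by blast
qed

lemma unit_in_cover_units:
  assumes x: "x \<in> units G"
  shows "{x} \<in> topspace (cover_units G)"
proof -
  let ?T = "fell_topology (gtop G)"
  \<comment> \<open>The basic open set without conditions consists of all closed sets, so every
    closed set is a point of the Fell space.\<close>
  have "openin ?T {F. closedin (gtop G) F \<and> (\<forall>U\<in>{}. F \<inter> U \<noteq> {}) \<and> F \<inter> {} = {}}" (is "openin _ ?O")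
    by (intro openin_fell) auto
  then have "?O \<subseteq> topspace ?T" by (rule openin_subset)
  moreover have "{x} \<in> ?O" using closedin_unit[OF x] by simp
  ultimately have T: "{x} \<in> topspace ?T" by (rule subsetD)
  define N where "N = subtopology ?T {F. F \<noteq> {}}"
  define H where "H = subtopology N (N closure_of {{g} | g. g \<in> arrows G})"
  have eq: "cover_units G = subtopology H (H closure_of {{x} | x. x \<in> units G})"
    by (simp add: cover_units_def hausdorff_cover_def Let_def N_def H_def)
  have "{x} \<in> topspace N" using T by (simp add: N_def)
  then have "{x} \<in> topspace H"
    using x unit_arrow unfolding H_def by (auto simp: in_closure_of)
  then show ?thesis
    using x unfolding eq by (auto simp: in_closure_of)
qed

lemma cover_units_closedin:
  assumes "F \<in> topspace (cover_units G)"
  shows "closedin (gtop G) F"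
proof -
  have "F \<in> topspace (fell_topology (gtop G))"
    using assms by (auto simp: cover_units_def hausdorff_cover_def Let_def)
  then show ?thesis
    unfolding fell_topology_def by auto
qed

text \<open>A member of the cover's unit space is a Fell limit of singletons \<open>{x}\<close>. If
  it contained two units, it would meet disjoint open sets \<open>A\<close> and \<open>B\<close>,
  and so would some \<open>{x}\<close>, putting \<open>x\<close> in both.\<close>

lemma cover_proj_eqI:
  assumes F: "F \<in> topspace (cover_units G)" and y: "y \<in> F" "y \<in> units G"
  shows "cover_proj G F = y"
proof -
  have "z = y" if z: "z \<in> F" "z \<in> units G" for z
  proof (rule ccontr)
    assume "z \<noteq> y"
    then obtain A B where AB: "openin (unit_top G) A" "openin (unit_top G) B" "z \<in> A" "y \<in> B" "A \<inter> B = {}"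
      using units_separated z y by metis
    let ?O = "{F. closedin (gtop G) F \<and> (\<forall>U\<in>{A, B}. F \<inter> U \<noteq> {}) \<and> F \<inter> {} = {}}"
    have "openin (fell_topology (gtop G)) ?O"
      using AB openin_unit_top by (intro openin_fell) auto
    moreover have "F \<in> ?O"
    proof -
      have "F \<inter> A \<noteq> {}" "F \<inter> B \<noteq> {}" using z y AB(3,4) by blast+
      then show ?thesis using cover_units_closedin[OF F] by simp
    qed
    ultimately obtain x where "{x} \<in> ?O" using cover_unitsD[OF F] by meson
    then have "x \<in> A" "x \<in> B" by simp_all
    then show False using AB(5) by blast
  qed
  then have "F \<inter> units G = {y}" using y by blast
  then show ?thesis by (simp add: cover_proj_def)
qed

text \<open>Meeting \<open>A\<close> and missing \<open>K\<close> is a Fell-open condition satisfied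
  by \<open>{x}\<close>. As the preimage of \<open>non_Hausdorff_units G\<close> has empty interior,
  some \<open>F\<close> in the cover satisfies the condition and projects outside that set.\<close>

lemma exists_Hausdorff_unit_off_compact:
  assumes sing: "cover_units_sing G = {}"
    and A: "openin (unit_top G) A" "x \<in> A" and K: "compactin (gtop G) K" "x \<notin> K"
  obtains y where "y \<in> A" "y \<notin> K" "y \<notin> non_Hausdorff_units G"
proof -
  have x: "x \<in> units G" using A(2) openin_subset[OF A(1)] by auto
  let ?O = "{F. closedin (gtop G) F \<and> (\<forall>U\<in>{A}. F \<inter> U \<noteq> {}) \<and> F \<inter> K = {}}"
  let ?C = "cover_units G"
  have O: "openin (fell_topology (gtop G)) ?O"
    using openin_unit_top[OF A(1)] K(1) by (intro openin_fell) simp_all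
  have xO: "{x} \<in> ?O \<inter> topspace ?C"
    using closedin_unit[OF x] unit_in_cover_units[OF x] A(2) K(2) by simp
  have open_cover: "openin ?C (?O \<inter> topspace ?C)"
    using O by (rule openin_cover_units)
  have "\<not> ?O \<inter> topspace ?C \<subseteq> {F \<in> topspace ?C. cover_proj G F \<in> non_Hausdorff_units G}" (is "\<not> _ \<subseteq> ?D")
  proof
    assume "?O \<inter> topspace ?C \<subseteq> ?D"
    then have "?O \<inter> topspace ?C \<subseteq> ?C interior_of ?D"
      using open_cover by (rule interior_of_maximal)
    then have "{x} \<in> ?C interior_of ?D" using xO by (rule subsetD)
    then show False using sing by (simp add: cover_units_sing_def)
  qed
  then obtain F where F: "F \<in> ?O" "F \<in> topspace ?C" "cover_proj G F \<notin> non_Hausdorff_units G"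
    by blast
  \<comment> \<open>\<open>F\<close> may contain arrows besides \<open>y\<close>, but since
    \<open>A\<close> consists of units, \<open>y\<close> is its only unit and hence its
    projection.\<close>
  then obtain y where y: "y \<in> F" "y \<in> A" by auto
  have "y \<in> units G" using y(2) openin_subset[OF A(1)] by auto
  then have "cover_proj G F = y" using F(2) y(1) by (intro cover_proj_eqI)
  moreover have "y \<notin> K" using F(1) y(1) by blast
  ultimately show thesis using that y(2) F(3) by blast
qed

text \<open>The filter property is used twice. At \<open>g\<close> it supplies an arrow
  \<open>h\<close> satisfying \<open>P\<close> with range outside
  \<open>non_Hausdorff_units G\<close>. At \<open>h\<close> the excluded compact set
  \<open>L\<close> can be avoided by a neighbourhood \<open>N\<close> of the range, which leaves a
  genuine open set.\<close>

lemma exists_open_if_eventually_off_compact: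
  assumes sing: "cover_units_sing G = {}"
    and ev: "\<And>g. g \<in> arrows G \<Longrightarrow> P g \<Longrightarrow> eventually P (nhds_off_compact g)"
    and g: "g \<in> arrows G" "P g"
  obtains W where "openin (gtop G) W" "W \<noteq> {}" "\<And>w. w \<in> W \<Longrightarrow> P w"
proof -
  obtain W K where WK: "openin (gtop G) W" "g \<in> W" "compactin (gtop G) K" "rng G g \<notin> K"
      "\<And>w. w \<in> W \<Longrightarrow> rng G w \<notin> K \<Longrightarrow> P w"
    using ev[OF g] g(1) by (rule eventually_nhds_off_compactE) blast
  have open_W: "openin (unit_top G) (rng G ` W)" using open_map_rng WK by (simp add: open_map_def)
  have "rng G g \<in> rng G ` W" using WK(2) by (rule imageI)
  then obtain y where y: "y \<in> rng G ` W" "y \<notin> K" "y \<notin> non_Hausdorff_units G"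
    using exists_Hausdorff_unit_off_compact[OF sing open_W _ WK(3,4)] by metis
  from y(1) obtain h where h: "h \<in> W" "y = rng G h" by blast
  have ha: "h \<in> arrows G" using h(1) openin_subset[OF WK(1)] by blast
  have "P h" using WK(5) h y(2) by simp
  obtain V L where VL: "openin (gtop G) V" "h \<in> V" "compactin (gtop G) L" "rng G h \<notin> L"
      "\<And>w. w \<in> V \<Longrightarrow> rng G w \<notin> L \<Longrightarrow> P w"
    using ev[OF ha \<open>P h\<close>] ha by (rule eventually_nhds_off_compactE) blast
  obtain N where N: "openin (unit_top G) N" "y \<in> N" "N \<inter> L = {}"
    using compact_avoids_Hausdorff_unit[OF _ y(3) VL(3)] VL(4) h(2) rng_in[OF ha] by metis
  show thesis
  proof
    show "openin (gtop G) (V \<inter> {w \<in> arrows G. rng G w \<in> N})"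
      using VL(1) openin_rng_vimage[OF N(1)] by (rule openin_Int)
    show "V \<inter> {w \<in> arrows G. rng G w \<in> N} \<noteq> {}"
      using VL(2) ha h(2) N(2) by blast
    show "P w" if "w \<in> V \<inter> {w \<in> arrows G. rng G w \<in> N}" for w
      using that VL(5) N(3) by blast
  qed
qed

section \<open>The singular ideal over a ring\<close>

lemma ring_singular_ideal_trivial:
  assumes sing: "cover_units_sing G = {}"
  shows "ring_singular_ideal G = {(\<lambda>g. 0) :: 'a \<Rightarrow> 'r::ring}"
proof (intro equalityI subsetI)
  fix f :: "'a \<Rightarrow> 'r" assume "f \<in> ring_singular_ideal G"
  then have f: "f \<in> ring_algebra G" and int: "gtop G interior_of (open_support G f) = {}"
    by (auto simp: ring_singular_ideal_def)
  have "f g = 0" for g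
  proof (cases "g \<in> arrows G")
    case True
    show ?thesis
    proof (rule ccontr)
      assume nz: "f g \<noteq> 0"
      have "eventually (\<lambda>w. f w \<noteq> 0) (nhds_off_compact h)" if "h \<in> arrows G" "f h \<noteq> 0" for h
        using eventually_eq_ring_algebra[OF f that(1)] that(2) by (auto elim: eventually_mono)
      then obtain W where W: "openin (gtop G) W" "W \<noteq> {}" "\<And>w. w \<in> W \<Longrightarrow> f w \<noteq> 0"
        using exists_open_if_eventually_off_compact[where P = "\<lambda>w. f w \<noteq> 0", OF sing _ True nz] by blast
      then have "W \<subseteq> open_support G f" using openin_subset by (fastforce simp: open_support_def)
      then show False using int W interior_of_maximal by blast
    qed
  next
    case False
    obtain n :: nat and U c where n: "f = (\<lambda>g. \<Sum>i<n. if g \<in> U i then c i else 0)"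
      and U: "\<And>i. i < n \<Longrightarrow> compactin (gtop G) (U i)"
      using f unfolding ring_algebra_def by blast
    \<comment> \<open>Functions are total, so equality with 0 must also be checked off the groupoid;
      there no \<open>U i\<close> contributes.\<close>
    have "g \<notin> U i" if "i < n" for i
      using False U[OF that] compactin_subset_topspace by blast
    then show ?thesis unfolding n by (intro sum.neutral) auto
  qed
  then show "f \<in> {\<lambda>g. 0}" by auto
next
  fix f :: "'a \<Rightarrow> 'r" assume "f \<in> {\<lambda>g. 0}"
  moreover have "(\<lambda>g. 0 :: 'r) \<in> ring_algebra G"
    unfolding ring_algebra_def by (intro CollectI exI[of _ 0]) auto
  ultimately show "f \<in> ring_singular_ideal G"
    by (simp add: ring_singular_ideal_def open_support_def)
qed

end

section \<open>Square-summable functions\<close>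

lemma cmod_le_l2_norm:
  assumes "\<xi> \<in> l2 A"
  shows "cmod (\<xi> a) \<le> l2_norm A \<xi>"
proof (cases "a \<in> A")
  case True
  have "(\<Sum>b\<in>{a}. (cmod (\<xi> b))\<^sup>2) \<le> (\<Sum>\<^sub>\<infinity>b\<in>A. (cmod (\<xi> b))\<^sup>2)"
    using assms True by (intro finite_sum_le_infsum) (auto simp: l2_def)
  then show ?thesis unfolding l2_norm_def by (intro real_le_rsqrt) simp
next
  case False
  then have "\<xi> a = 0" using assms by (auto simp: l2_def)
  then show ?thesis by (simp add: l2_norm_def infsum_nonneg)
qed

lemma l2_norm_nonneg: "0 \<le> l2_norm A \<xi>"
  by (simp add: l2_norm_def infsum_nonneg)

lemma l2_norm_zero [simp]: "l2_norm A (\<lambda>a. 0) = 0"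
  by (simp add: l2_norm_def)

lemma l2_norm_scale: "l2_norm A (\<lambda>a. c * \<xi> a) = cmod c * l2_norm A \<xi>"
proof -
  have "(\<Sum>\<^sub>\<infinity>a\<in>A. (cmod (c * \<xi> a))\<^sup>2) = (cmod c)\<^sup>2 * (\<Sum>\<^sub>\<infinity>a\<in>A. (cmod (\<xi> a))\<^sup>2)"
    by (simp add: norm_mult power_mult_distrib infsum_cmult_right')
  then show ?thesis by (simp add: l2_norm_def real_sqrt_mult)
qed

lemma l2_finite_support:
  assumes "finite {a. \<xi> a \<noteq> 0}" "{a. \<xi> a \<noteq> 0} \<subseteq> A"
  shows "\<xi> \<in> l2 A"
proof -
  have "(\<lambda>a. (cmod (\<xi> a))\<^sup>2) summable_on {a. \<xi> a \<noteq> 0}"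
    using assms(1) by simp
  then have "(\<lambda>a. (cmod (\<xi> a))\<^sup>2) summable_on A"
    using assms(2) by (subst summable_on_cong_neutral[where T = "{a. \<xi> a \<noteq> 0}"]) auto
  then show ?thesis using assms(2) by (auto simp: l2_def)
qed

lemma l2_delta_in_l2: "a \<in> A \<Longrightarrow> l2_delta a \<in> l2 A"
  by (intro l2_finite_support) (auto simp: l2_delta_def)

lemma l2_norm_delta: "a \<in> A \<Longrightarrow> l2_norm A (l2_delta a) = 1"
proof -
  assume "a \<in> A"
  then have "(\<Sum>\<^sub>\<infinity>b\<in>A. (cmod (l2_delta a b))\<^sup>2) = (\<Sum>\<^sub>\<infinity>b\<in>{a}. (cmod (l2_delta a b))\<^sup>2)"
    by (intro infsum_cong_neutral) (auto simp: l2_delta_def)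
  then show ?thesis by (simp add: l2_norm_def l2_delta_def)
qed

lemma l2_inner_delta: "a \<in> A \<Longrightarrow> l2_inner A \<xi> (l2_delta a) = \<xi> a"
proof -
  assume "a \<in> A"
  then have "(\<Sum>\<^sub>\<infinity>b\<in>A. \<xi> b * cnj (l2_delta a b)) = (\<Sum>\<^sub>\<infinity>b\<in>{a}. \<xi> b * cnj (l2_delta a b))"
    by (intro infsum_cong_neutral) (auto simp: l2_delta_def)
  then show ?thesis by (simp add: l2_inner_def l2_delta_def)
qed

lemma l2_scale: "\<xi> \<in> l2 A \<Longrightarrow> (\<lambda>a. c * \<xi> a) \<in> l2 A"
  by (auto simp: l2_def norm_mult power_mult_distrib intro: summable_on_cmult_right)

lemma l2_restrict:
  assumes "\<xi> \<in> l2 A"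
  shows "(\<lambda>a. if a \<in> B then \<xi> a else 0) \<in> l2 A"
proof -
  have "(\<lambda>a. (cmod (if a \<in> B then \<xi> a else 0))\<^sup>2) summable_on A"
    by (rule summable_on_comparison_test[where f = "\<lambda>a. (cmod (\<xi> a))\<^sup>2"]) (use assms in \<open>auto simp: l2_def\<close>)
  then show ?thesis using assms by (auto simp: l2_def)
qed

lemma l2_diff:
  assumes "\<xi> \<in> l2 A" "\<eta> \<in> l2 A"
  shows "(\<lambda>a. \<xi> a - \<eta> a) \<in> l2 A"
proof -
  have le: "(cmod (z - w))\<^sup>2 \<le> 2 * (cmod z)\<^sup>2 + 2 * (cmod w)\<^sup>2" for z w :: complex
  proof -
    have "(cmod (z - w))\<^sup>2 \<le> (cmod z + cmod w)\<^sup>2"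
      by (intro power_mono norm_triangle_ineq4) simp
    moreover have "0 \<le> (cmod z - cmod w)\<^sup>2" by simp
    ultimately show ?thesis by (simp add: power2_eq_square algebra_simps)
  qed
  have "(\<lambda>a. 2 * (cmod (\<xi> a))\<^sup>2 + 2 * (cmod (\<eta> a))\<^sup>2) summable_on A"
    using assms by (intro summable_on_add summable_on_cmult_right) (auto simp: l2_def)
  then have "(\<lambda>a. (cmod (\<xi> a - \<eta> a))\<^sup>2) summable_on A"
    by (rule summable_on_comparison_test) (use le in auto)
  then show ?thesis using assms by (auto simp: l2_def)
qed

lemma l2_small_tail:
  assumes "\<xi> \<in> l2 A" "e > 0"
  obtains F where "finite F" "F \<subseteq> A" "l2_norm A (\<lambda>a. if a \<in> A - F then \<xi> a else 0) \<le> e"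
proof -
  let ?f = "\<lambda>a. (cmod (\<xi> a))\<^sup>2"
  have sum: "?f summable_on A" using assms by (simp add: l2_def)
  obtain F where F: "finite F" "F \<subseteq> A" "dist (sum ?f F) (infsum ?f A) \<le> e\<^sup>2"
    using infsum_finite_approximation[OF sum, of "e\<^sup>2"] assms(2) by auto
  have "infsum (\<lambda>a. (cmod (if a \<in> A - F then \<xi> a else 0))\<^sup>2) A = infsum ?f (A - F)"
    by (intro infsum_cong_neutral) auto
  also have "\<dots> = infsum ?f A - sum ?f F"
    using infsum_Diff[OF sum _ F(2)] F(1) by simp
  also have "\<dots> \<le> e\<^sup>2" using F(3) by (simp add: dist_real_def)
  finally have "l2_norm A (\<lambda>a. if a \<in> A - F then \<xi> a else 0) \<le> sqrt (e\<^sup>2)"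
    unfolding l2_norm_def by (rule real_sqrt_le_mono)
  then show thesis using that F assms(2) by simp
qed

section \<open>Elements of the reduced algebra as functions\<close>

lemma family_norm_lessD:
  assumes "family_norm G a < ennreal e" "x \<in> units G"
    and "\<xi> \<in> l2 (source_fibre G x)" "l2_norm (source_fibre G x) \<xi> \<le> 1"
  shows "l2_norm (source_fibre G x) (a x \<xi>) < e"
proof -
  have "ennreal (l2_norm (source_fibre G x) (a x \<xi>)) \<le> family_norm G a"
    unfolding family_norm_def using assms(2-4)
    by (intro SUP_upper2[of x] SUP_upper2[of \<xi>]) auto
  then have "ennreal (l2_norm (source_fibre G x) (a x \<xi>)) < ennreal e"
    using assms(1) by (rule le_less_trans)
  then show ?thesis by (simp add: ennreal_less_iff l2_norm_nonneg)
qed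

context groupoid
begin

lemma mul_inv_unit:
  assumes "g \<in> arrows G"
  shows "mul G g (ginv G (src G g)) = g"
  using mul_inv_cancel_right[of g "src G g"] assms
  by (simp add: composable_iff src_in unit_arrow rng_unit unit_right)

text \<open>For \<open>m\<close> with the same source as \<open>k\<close>, the only \<open>p\<close>
  with \<open>p^{-1} m = k\<close> is \<open>p = m k^{-1}\<close>, so the infinite sum has one
  nonzero term at most. For an arrow \<open>m\<close> with another source, \<open>p^{-1} m\<close>
  never equals \<open>k\<close>.\<close>

lemma convolution_delta:
  assumes k: "k \<in> arrows G"
  shows "convolution G h (l2_delta k) =
    (\<lambda>m. if m \<in> source_fibre G (src G k) then h (mul G m (ginv G k)) else 0)"
proof
  fix m
  let ?R = "{p \<in> arrows G. rng G p = rng G m}"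
  show "convolution G h (l2_delta k) m =
    (if m \<in> source_fibre G (src G k) then h (mul G m (ginv G k)) else 0)"
  proof (cases "m \<in> source_fibre G (src G k)")
    case True
    then have m: "m \<in> arrows G" "src G m = src G k" by (auto simp: source_fibre_def)
    let ?q = "mul G m (ginv G k)"
    have q: "?q \<in> arrows G" "rng G ?q = rng G m" "src G ?q = rng G k"
      using mul_inv_in[OF m(1) k m(2)] by auto
    have "mul G ?q k = m" using mul_inv_cancel_right'[OF m(1) k m(2)] .
    then have qm: "mul G (ginv G ?q) m = k"
      using mul_inv_cancel_left[of "ginv G ?q" k] q k by (simp add: inv_in rng_inv inv_inv)
    have p: "p = ?q" if "p \<in> ?R" "mul G (ginv G p) m = k" for p
    proof -
      have "(p, k) \<in> composable G"
        using that m k src_mul rng_mul[of "ginv G p" m] by (auto simp: composable_iff inv_in rng_inv src_inv)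
      moreover have "mul G p k = m" using that m mul_inv_cancel_left[of p m] by auto
      ultimately show ?thesis using mul_inv_cancel_right[of p k] by simp
    qed
    have "(\<Sum>\<^sub>\<infinity>p\<in>?R. h p * l2_delta k (mul G (ginv G p) m)) =
        (\<Sum>\<^sub>\<infinity>p\<in>{?q}. h p * l2_delta k (mul G (ginv G p) m))"
      using p q by (intro infsum_cong_neutral) (auto simp: l2_delta_def)
    then show ?thesis using True m qm by (simp add: convolution_def l2_delta_def)
  next
    case False
    have "l2_delta k (mul G (ginv G p) m) = 0" if "m \<in> arrows G" "p \<in> ?R" for p
    proof -
      have "src G (mul G (ginv G p) m) = src G m"
        using that by (intro src_mul) (auto simp: composable_iff inv_in src_inv)
      then show ?thesis using False that by (auto simp: l2_delta_def source_fibre_def)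
    qed
    then have "(\<Sum>\<^sub>\<infinity>p\<in>?R. h p * l2_delta k (mul G (ginv G p) m)) = 0" if "m \<in> arrows G"
      using that by (intro infsum_0) simp
    then show ?thesis using False by (simp add: convolution_def)
  qed
qed

text \<open>The source is injective on a bisection, which therefore meets a source fibre in at most
  one arrow; \<open>h\<close> is a finite combination of functions supported on bisections.\<close>

lemma finite_Cc_source_fibre:
  assumes "h \<in> Cc_algebra G"
  shows "finite {g \<in> source_fibre G y. h g \<noteq> 0}"
proof -
  obtain F c where F: "h = (\<lambda>g. \<Sum>\<phi>\<in>F. c \<phi> * \<phi> g)" "finite F"
      "F \<subseteq> (\<Union>U\<in>{U. open_bisection G U}. Cc_bisection G U)"
    using assms unfolding Cc_algebra_def by blast
  have "finite {g \<in> source_fibre G y. \<phi> g \<noteq> 0}" if "\<phi> \<in> F" for \<phi>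
  proof -
    obtain U where U: "open_bisection G U" "\<phi> \<in> Cc_bisection G U" using F(3) \<open>\<phi> \<in> F\<close> by auto
    let ?S = "{g \<in> source_fibre G y. \<phi> g \<noteq> 0}"
    have "?S \<subseteq> U" using U(2) by (auto simp: Cc_bisection_def)
    then have "inj_on (src G) ?S" using U(1) by (auto simp: open_bisection_def intro: inj_on_subset)
    moreover have "src G ` ?S \<subseteq> {y}" by (auto simp: source_fibre_def)
    ultimately show ?thesis by (meson finite.emptyI finite_insert inj_on_finite)
  qed
  then have "finite (\<Union>\<phi>\<in>F. {g \<in> source_fibre G y. \<phi> g \<noteq> 0})" using F(2) by blast
  moreover have "{g \<in> source_fibre G y. h g \<noteq> 0} \<subseteq> (\<Union>\<phi>\<in>F. {g \<in> source_fibre G y. \<phi> g \<noteq> 0})"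
  proof
    fix g assume g: "g \<in> {g \<in> source_fibre G y. h g \<noteq> 0}"
    then have "\<exists>\<phi>\<in>F. c \<phi> * \<phi> g \<noteq> 0" unfolding F(1) by (metis (mono_tags, lifting) mem_Collect_eq sum.neutral)
    then show "g \<in> (\<Union>\<phi>\<in>F. {g \<in> source_fibre G y. \<phi> g \<noteq> 0})" using g by auto
  qed
  ultimately show ?thesis by (rule finite_subset[rotated])
qed

lemma regular_rep_delta:
  assumes "x \<in> units G" "k \<in> source_fibre G x"
  shows "regular_rep G h x (l2_delta k) = (\<lambda>m. if m \<in> source_fibre G x then h (mul G m (ginv G k)) else 0)"
  using assms convolution_delta[of k h] l2_delta_in_l2[of k "source_fibre G x"]
  by (simp add: regular_rep_def) (simp add: source_fibre_def)

text \<open>The vector has finite support: \<open>m \<mapsto> m k^{-1}\<close> injects its support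
  into the fibre over \<open>rng G k\<close>, where \<open>h\<close> has only finitely many nonzero
  values.\<close>

lemma regular_rep_delta_in_l2:
  assumes h: "h \<in> Cc_algebra G" and x: "x \<in> units G" and k: "k \<in> source_fibre G x"
  shows "regular_rep G h x (l2_delta k) \<in> l2 (source_fibre G x)"
proof -
  let ?S = "{m \<in> source_fibre G x. h (mul G m (ginv G k)) \<noteq> 0}"
  have ka: "k \<in> arrows G" "src G k = x" using k by (auto simp: source_fibre_def)
  have "inj_on (\<lambda>m. mul G m (ginv G k)) ?S"
  proof (rule inj_on_inverseI)
    fix m assume "m \<in> ?S"
    then show "mul G (mul G m (ginv G k)) k = m"
      using ka by (intro mul_inv_cancel_right') (auto simp: source_fibre_def)
  qed
  moreover have "(\<lambda>m. mul G m (ginv G k)) ` ?S \<subseteq> {g \<in> source_fibre G (rng G k). h g \<noteq> 0}"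
    using ka mul_inv_in by (auto simp: source_fibre_def)
  ultimately have "finite ?S" using finite_Cc_source_fibre[OF h] by (rule inj_on_finite)
  moreover have "{m. regular_rep G h x (l2_delta k) m \<noteq> 0} = ?S"
    by (auto simp: regular_rep_delta[OF x k])
  ultimately show ?thesis by (intro l2_finite_support) auto
qed

text \<open>The vector \<open>l2_delta k\<close> has norm 1, so each matrix coefficient of the
  difference is bounded by its family norm.\<close>

lemma reduced_algebra_approx:
  assumes a: "a \<in> reduced_algebra G" and e: "e > 0"
  obtains h where "h \<in> Cc_algebra G"
    "\<And>x k m. x \<in> units G \<Longrightarrow> k \<in> source_fibre G x \<Longrightarrow> m \<in> source_fibre G x \<Longrightarrow>
      cmod (a x (l2_delta k) m - h (mul G m (ginv G k))) < e"
proof -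
  obtain h where h: "h \<in> Cc_algebra G"
      "family_norm G (\<lambda>x \<xi> g. a x \<xi> g - regular_rep G h x \<xi> g) < ennreal e"
    using a e unfolding reduced_algebra_def by blast
  show thesis
  proof (rule that[OF h(1)])
    fix x k m assume x: "x \<in> units G" and k: "k \<in> source_fibre G x" and m: "m \<in> source_fibre G x"
    let ?A = "source_fibre G x"
    let ?d = "\<lambda>g. a x (l2_delta k) g - regular_rep G h x (l2_delta k) g"
    have "a x (l2_delta k) \<in> l2 ?A"
      using a x l2_delta_in_l2[OF k] by (auto simp: reduced_algebra_def bounded_families_def)
    then have "?d \<in> l2 ?A" using regular_rep_delta_in_l2[OF h(1) x k] by (rule l2_diff)
    then have "cmod (?d m) \<le> l2_norm ?A ?d" by (rule cmod_le_l2_norm)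
    also have "\<dots> < e"
      using family_norm_lessD[OF h(2) x l2_delta_in_l2[OF k]] by (simp add: l2_norm_delta[OF k])
    finally show "cmod (a x (l2_delta k) m - h (mul G m (ginv G k))) < e"
      using m by (simp add: regular_rep_delta[OF x k])
  qed
qed

lemma family_fun_arrow:
  assumes "g \<in> arrows G"
  shows "family_fun G a g = a (src G g) (l2_delta (src G g)) g"
  using assms by (simp add: family_fun_def l2_inner_delta source_fibre_def)

text \<open>The first estimate is the second at \<open>k = src G g\<close>. One \<open>h\<close>
  serves both, so that \<open>family_fun\<close> can be compared with all matrix
  coefficients.\<close>

lemma family_fun_approx:
  assumes a: "a \<in> reduced_algebra G" and e: "e > 0"
  obtains h where "h \<in> Cc_algebra G"
    "\<And>g. g \<in> arrows G \<Longrightarrow> cmod (family_fun G a g - h g) < e"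
    "\<And>x k m. x \<in> units G \<Longrightarrow> k \<in> source_fibre G x \<Longrightarrow> m \<in> source_fibre G x \<Longrightarrow>
      cmod (a x (l2_delta k) m - h (mul G m (ginv G k))) < e"
proof -
  obtain h where h: "h \<in> Cc_algebra G"
    "\<And>x k m. x \<in> units G \<Longrightarrow> k \<in> source_fibre G x \<Longrightarrow> m \<in> source_fibre G x \<Longrightarrow>
      cmod (a x (l2_delta k) m - h (mul G m (ginv G k))) < e"
    using reduced_algebra_approx[OF a e] by blast
  have "cmod (family_fun G a g - h g) < e" if g: "g \<in> arrows G" for g
  proof -
    have "src G g \<in> source_fibre G (src G g)" "g \<in> source_fibre G (src G g)"
      using g src_in[OF g] by (simp_all add: source_fibre_def src_unit unit_arrow)
    then show ?thesis
      using h(2)[OF src_in[OF g]] g by (metis family_fun_arrow mul_inv_unit)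
  qed
  with h show thesis using that by blast
qed

text \<open>Right translation by \<open>k\<close> intertwines the representations at \<open>rng G k\<close> and \<open>src G k\<close>.\<close>

lemma reduced_algebra_delta:
  assumes a: "a \<in> reduced_algebra G"
    and x: "x \<in> units G" and k: "k \<in> source_fibre G x" and m: "m \<in> source_fibre G x"
  shows "a x (l2_delta k) m = family_fun G a (mul G m (ginv G k))"
proof (rule ccontr)
  let ?g = "mul G m (ginv G k)"
  let ?d = "a x (l2_delta k) m - family_fun G a ?g"
  assume "a x (l2_delta k) m \<noteq> family_fun G a ?g"
  then have "cmod ?d / 2 > 0" by simp
  then obtain h where h: "cmod (family_fun G a ?g - h ?g) < cmod ?d / 2"
      "cmod (a x (l2_delta k) m - h ?g) < cmod ?d / 2"
    using family_fun_approx[OF a] x k m mul_inv_in(1)[of m k]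
    by (metis (mono_tags, lifting) mem_Collect_eq source_fibre_def)
  have "cmod ?d \<le> cmod (a x (l2_delta k) m - h ?g) + cmod (family_fun G a ?g - h ?g)"
    using norm_triangle_ineq4[of "a x (l2_delta k) m - h ?g" "family_fun G a ?g - h ?g"] by simp
  then show False using h by simp
qed

text \<open>Linearity gives 0 on finitely supported vectors; these are dense, and boundedness
  extends the vanishing to every \<xi>.\<close>

lemma bounded_families_eq_zero_if_delta:
  assumes a: "a \<in> bounded_families G"
    and zero: "\<And>x k. x \<in> units G \<Longrightarrow> k \<in> source_fibre G x \<Longrightarrow> a x (l2_delta k) = (\<lambda>g. 0)"
  shows "a = (\<lambda>x \<xi> g. 0)"
proof (intro ext)
  fix x \<xi> m
  let ?A = "source_fibre G x"
  show "a x \<xi> m = 0"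
  proof (cases "x \<in> units G \<and> \<xi> \<in> l2 ?A")
    case False
    then show ?thesis using a by (auto simp: bounded_families_def)
  next
    case True
    then have x: "x \<in> units G" and \<xi>: "\<xi> \<in> l2 ?A" by auto
    have in_l2: "a x \<eta> \<in> l2 ?A" if "\<eta> \<in> l2 ?A" for \<eta>
      using a x that by (auto simp: bounded_families_def)
    have add: "a x (\<lambda>g. \<eta> g + \<zeta> g) = (\<lambda>g. a x \<eta> g + a x \<zeta> g)" if "\<eta> \<in> l2 ?A" "\<zeta> \<in> l2 ?A" for \<eta> \<zeta>
      using a x that by (auto simp: bounded_families_def)
    have scale: "a x (\<lambda>g. c * \<eta> g) = (\<lambda>g. c * a x \<eta> g)" if "\<eta> \<in> l2 ?A" for \<eta> c
      using a x that by (auto simp: bounded_families_def)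
    have fin: "a x (\<lambda>g. if g \<in> F then \<xi> g else 0) = (\<lambda>g. 0)" if "finite F" "F \<subseteq> ?A" for F
      using that
    proof (induction F)
      case empty
      \<comment> \<open>The zero vector is \<open>0 * \<xi>\<close>, so homogeneity covers the empty
        set.\<close>
      then show ?case using scale[OF \<xi>, of 0] by simp
    next
      case (insert k F)
      have "(\<lambda>g. if g \<in> insert k F then \<xi> g else 0) =
          (\<lambda>g. (if g \<in> F then \<xi> g else 0) + \<xi> k * l2_delta k g)"
        using insert.hyps by (auto simp: l2_delta_def)
      moreover have "l2_delta k \<in> l2 ?A" using insert.prems by (intro l2_delta_in_l2) simp
      ultimately show ?case
        using insert add[OF l2_restrict[OF \<xi>] l2_scale] scale zero[OF x] by simp
    qed
    obtain C where "family_norm G a < ennreal C"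
    proof -
      have "family_norm G a < top" using a by (simp add: bounded_families_def)
      then obtain n where "family_norm G a < of_nat n" using ennreal_Ex_less_of_nat by blast
      then show thesis using that by (metis ennreal_of_nat_eq_real_of_nat)
    qed
    then have bound: "l2_norm ?A (a x \<eta>) < C" if "\<eta> \<in> l2 ?A" "l2_norm ?A \<eta> \<le> 1" for \<eta>
      using that x by (intro family_norm_lessD)
    have small: "cmod (a x \<xi> m) \<le> e * C" if e: "e > 0" for e
    proof -
      obtain F where F: "finite F" "F \<subseteq> ?A" "l2_norm ?A (\<lambda>g. if g \<in> ?A - F then \<xi> g else 0) \<le> e"
        using l2_small_tail[OF \<xi> e] by blast
      let ?\<eta> = "\<lambda>g. if g \<in> ?A - F then \<xi> g else 0"
      have \<eta>: "?\<eta> \<in> l2 ?A" using \<xi> by (rule l2_restrict)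
      have "\<xi> = (\<lambda>g. (if g \<in> F then \<xi> g else 0) + ?\<eta> g)"
        using \<xi> F(2) by (auto simp: l2_def)
      then have "a x \<xi> = a x (\<lambda>g. (if g \<in> F then \<xi> g else 0) + ?\<eta> g)"
        by (rule arg_cong)
      also have "\<dots> = a x ?\<eta>"
        unfolding add[OF l2_restrict[OF \<xi>] \<eta>] fin[OF F(1,2)] by simp
      finally have eq: "a x \<xi> = a x ?\<eta>" .
      \<comment> \<open>The tail has norm at most \<open>e\<close>; dividing by \<open>e\<close>
        brings it into the unit ball, where the bound \<open>C\<close> applies.\<close>
      let ?c = "complex_of_real (1 / e)"
      have "l2_norm ?A (\<lambda>g. ?c * ?\<eta> g) \<le> 1"
        unfolding l2_norm_scale using F(3) e by (simp add: norm_divide)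
      then have "l2_norm ?A (a x (\<lambda>g. ?c * ?\<eta> g)) < C"
        using \<eta> by (intro bound l2_scale)
      moreover have "cmod (a x (\<lambda>g. ?c * ?\<eta> g) m) \<le> l2_norm ?A (a x (\<lambda>g. ?c * ?\<eta> g))"
        using \<eta> by (intro cmod_le_l2_norm in_l2 l2_scale)
      ultimately have "cmod (a x (\<lambda>g. ?c * ?\<eta> g) m) < C" by linarith
      then have "cmod (?c * a x ?\<eta> m) < C" unfolding scale[OF \<eta>] .
      then show ?thesis
        using e eq by (simp add: norm_mult norm_divide field_simps)
    qed
    have C: "C > 0" using bound[of "\<lambda>g. 0"] l2_norm_nonneg[of ?A "a x (\<lambda>g. 0)"]
      l2_scale[OF \<xi>, of 0] by simp
    show ?thesis
    proof (rule ccontr)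
      assume "a x \<xi> m \<noteq> 0"
      \<comment> \<open>This choice of \<open>e\<close> bounds the coefficient by half of
        itself.\<close>
      then have "cmod (a x \<xi> m) / (2 * C) > 0" using C by simp
      from small[OF this] have "cmod (a x \<xi> m) \<le> cmod (a x \<xi> m) / 2" using C by simp
      then show False using \<open>a x \<xi> m \<noteq> 0\<close> by simp
    qed
  qed
qed

lemma reduced_algebra_eq_zero_if_family_fun:
  assumes a: "a \<in> reduced_algebra G" and zero: "\<And>g. g \<in> arrows G \<Longrightarrow> family_fun G a g = 0"
  shows "a = (\<lambda>x \<xi> g. 0)"
proof (rule bounded_families_eq_zero_if_delta)
  show b: "a \<in> bounded_families G" using a by (simp add: reduced_algebra_def)
  fix x k assume x: "x \<in> units G" and k: "k \<in> source_fibre G x"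
  show "a x (l2_delta k) = (\<lambda>g. 0)"
  proof
    fix m
    show "a x (l2_delta k) m = 0"
    proof (cases "m \<in> source_fibre G x")
      case True
      then have "mul G m (ginv G k) \<in> arrows G"
        using k by (intro mul_inv_in) (auto simp: source_fibre_def)
      then show ?thesis using reduced_algebra_delta[OF a x k True] zero by simp
    next
      case False
      have "a x (l2_delta k) \<in> l2 (source_fibre G x)"
        using b x l2_delta_in_l2[OF k] by (auto simp: bounded_families_def)
      then show ?thesis using False by (auto simp: l2_def)
    qed
  qed
qed

lemma zero_in_reduced_algebra: "(\<lambda>x \<xi> g. 0) \<in> reduced_algebra G"
proof -
  have "family_norm G (\<lambda>x \<xi> g. 0) \<le> 0"
    unfolding family_norm_def by (intro SUP_least) simp
  then have norm: "family_norm G (\<lambda>x \<xi> g. 0) = 0" by simp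
  have "(\<lambda>g. 0) \<in> Cc_algebra G"
    unfolding Cc_algebra_def by (intro CollectI exI[of _ "{}"]) auto
  moreover have "regular_rep G (\<lambda>g. 0) x \<xi> g = 0" for x \<xi> g
    by (simp add: regular_rep_def convolution_def)
  ultimately show ?thesis
    using norm unfolding reduced_algebra_def bounded_families_def
    by (auto simp: l2_finite_support intro!: bexI[of _ "\<lambda>g. 0"])
qed

end

section \<open>The singular ideal of the reduced algebra\<close>

context etale_groupoid
begin

text \<open>Uniform approximation by \<open>Cc_algebra G\<close> carries convergence along the
  filter over to \<open>family_fun G a\<close>, so nonvanishing persists there and yields an open
  set \<open>W\<close> of nonvanishing. The source map is open, so the image of \<open>W\<close>
  would be interior to a set with empty interior.\<close>

lemma singular_ideal_trivial:
  assumes sing: "cover_units_sing G = {}"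
  shows "singular_ideal G = {\<lambda>x \<xi> g. 0}"
proof (intro equalityI subsetI)
  fix a assume "a \<in> singular_ideal G"
  then have a: "a \<in> reduced_algebra G"
    and int: "unit_top G interior_of (src G ` open_support G (family_fun G a)) = {}"
    by (auto simp: singular_ideal_def)
  let ?f = "family_fun G a"
  have ev: "eventually (\<lambda>w. ?f w \<noteq> 0) (nhds_off_compact g)" if g: "g \<in> arrows G" "?f g \<noteq> 0" for g
  proof -
    \<comment> \<open>If \<open>?f w = 0\<close>, then \<open>cmod (?f g)\<close> is at most the sum
      of \<open>cmod (?f g - h g)\<close>, \<open>cmod (h g - h w)\<close> and
      \<open>cmod (h w)\<close>, each below one third of it.\<close>
    have "cmod (?f g) / 3 > 0" using g by simp
    then obtain h where h: "h \<in> Cc_algebra G" "\<And>w. w \<in> arrows G \<Longrightarrow> cmod (?f w - h w) < cmod (?f g) / 3"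
      using family_fun_approx[OF a] by metis
    have "eventually (\<lambda>w. dist (h w) (h g) < cmod (?f g) / 3) (nhds_off_compact g)"
      using tendsto_Cc_algebra[OF h(1) g(1)] \<open>cmod (?f g) / 3 > 0\<close> by (rule tendstoD)
    moreover have "eventually (\<lambda>w. w \<in> arrows G) (nhds_off_compact g)"
      using g by (intro eventually_in_open_off_compact) auto
    ultimately show ?thesis
    proof eventually_elim
      case (elim w)
      show ?case
      proof
        assume "?f w = 0"
        then have "cmod (h w) < cmod (?f g) / 3" using h(2)[OF elim(2)] by simp
        moreover have "cmod (?f g) \<le> cmod (?f g - h g) + cmod (h g - h w) + cmod (h w)"
          using norm_triangle_ineq[of "?f g - h g" "h g - h w"] norm_triangle_ineq[of "?f g - h w" "h w"]
          by simp
        ultimately show False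
          using h(2)[OF g(1)] elim(1) by (simp add: dist_norm norm_minus_commute)
      qed
    qed
  qed
  have "?f g = 0" if "g \<in> arrows G" for g
  proof (rule ccontr)
    assume "?f g \<noteq> 0"
    with ev that obtain W where W: "openin (gtop G) W" "W \<noteq> {}" "\<And>w. w \<in> W \<Longrightarrow> ?f w \<noteq> 0"
      using exists_open_if_eventually_off_compact[where P = "\<lambda>g. ?f g \<noteq> 0", OF sing] by metis
    have "W \<subseteq> open_support G ?f"
      using W(3) openin_subset[OF W(1)] by (auto simp: open_support_def)
    then have "src G ` W \<subseteq> unit_top G interior_of (src G ` open_support G ?f)"
      by (intro interior_of_maximal image_mono openin_src_image W(1))
    then show False using int W(2) by simp
  qed
  then show "a \<in> {\<lambda>x \<xi> g. 0}" using reduced_algebra_eq_zero_if_family_fun[OF a] by simp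
next
  fix a :: "'a op_family" assume "a \<in> {\<lambda>x \<xi> g. 0}"
  moreover have "open_support G (family_fun G (\<lambda>x \<xi> g. 0)) = {}"
    by (simp add: open_support_def family_fun_def l2_inner_def)
  ultimately show "a \<in> singular_ideal G"
    using zero_in_reduced_algebra by (simp add: singular_ideal_def)
qed

end

theorem corollary4p17:
  fixes G :: "'g top_groupoid"
  assumes "etale_groupoid G"
    and "\<not> Hausdorff_space (gtop G)"
    and "\<exists>\<U>. countable \<U> \<and> (\<forall>U\<in>\<U>. open_bisection G U) \<and> \<Union>\<U> = arrows G"
    and "cover_units_sing G = {}"
  shows "singular_ideal G = {\<lambda>x \<xi> g. 0} \<and>
    (ample_groupoid G \<longrightarrow> ring_singular_ideal G = {(\<lambda>g. 0) :: 'g \<Rightarrow> 'r::ring})"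
proof -
  interpret etale_groupoid G by (rule assms(1))
  show ?thesis
    using singular_ideal_trivial ring_singular_ideal_trivial assms(4) by blast
qed

end
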